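(* Let $K$ be a locally compact Hausdorff space which is not $\sigma$-compact but contains a dense $\sigma$-compact subset, and suppose that $K$ is separable. Then there is no frame (standard or non-standard) in $C_0(K)$, regarded as a Hilbert module over the unitalization $\dot{C_0}(K)$ of $C_0(K)$.
   Context: A subset of a space is $\sigma$-compact if it is a countable union of compact subsets. $C_0(K)$ is the $C^*$-algebra of complex continuous functions on $K$ vanishing at infinity; it is a Hilbert module over itself, and over its unitalization, with inner product $\langle x,y\rangle=\overline{x}\,y$. $\dot{\mathcal A}$ denotes the unitalization of a $C^*$-algebra $\mathcal A$ (equal to $\mathcal A$ if $\mathcal A$ is unital). Frames: let $\mathcal N$ be a Hilbert $C^*$-module over a unital $C^*$-algebra $\mathcal A$. A family $\{x_j\}_{j\in J}$ (any index set) in $\mathcal N$ is a standard frame if there are constants $c_1,c_2>0$ such that for every $x\in\mathcal N$ the series $\sum_j\langle x,x_j\rangle\langle x_j,x\rangle$ converges in norm in $\mathcal A$ and $c_1\langle x,x\rangle\le\sum_j\langle x,x_j\rangle\langle x_j,x\rangle\le c_2\langle x,x\rangle$. It is a non-standard frame if the same holds with norm convergence replaced by convergence, in the ultraweak ($\sigma$-weak) topology, of the net of all finite partial sums to an element of the universal enveloping von Neumann algebra $\mathcal A''$ (the inequalities being understood in $\mathcal A''$). "Frame" means at least non-standard, i.e. the series converges at least ultraweakly. For a Hilbert module over a non-unital $\mathcal A$, frames are understood by viewing it as a module over $\dot{\mathcal A}$. *)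

theory Defs
  imports "HOL-Analysis.Analysis" "HOL-Algebra.Module"
begin

section \<open>C*-algebras and Hilbert modules as structures\<close>

text \<open>
  The field \<open>one\<close>, inherited from the ring records, carries information only when the
  algebra is unital; a non-unital algebra may have any value there.
\<close>

record 'x cstar = "(complex, 'x) module" +
  star :: "'x \<Rightarrow> 'x"
  cnorm :: "'x \<Rightarrow> real"

text \<open>\<open>m_act\<close> is the right action of the algebra, \<open>m_inner\<close> is conjugate-linear in the
  first and linear in the second argument.\<close>

record ('x, 'n) hilbert_module =
  m_carrier :: "'n set"
  m_zero :: 'n
  m_add :: "'n \<Rightarrow> 'n \<Rightarrow> 'n"
  m_act :: "'n \<Rightarrow> 'x \<Rightarrow> 'n"
  m_inner :: "'n \<Rightarrow> 'n \<Rightarrow> 'x"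

definition is_unit_of :: "'x cstar \<Rightarrow> 'x \<Rightarrow> bool" where
  "is_unit_of A e \<longleftrightarrow> e \<in> carrier A \<and>
     (\<forall>a\<in>carrier A. e \<otimes>\<^bsub>A\<^esub> a = a \<and> a \<otimes>\<^bsub>A\<^esub> e = a)"

definition unital :: "'x cstar \<Rightarrow> bool" where
  "unital A \<longleftrightarrow> (\<exists>e. is_unit_of A e)"

text \<open>
  The unitalization: pairs \<open>(a, r)\<close> stand for \<open>a + r 1\<close>. If \<open>A\<close> is unital, only the pairs
  \<open>(a, 0)\<close> are kept, so that the result is a copy of \<open>A\<close>. The norm is that of the
  operator of left multiplication on \<open>A\<close>.
\<close>

definition unitization :: "'x cstar \<Rightarrow> ('x \<times> complex) cstar" where
  "unitization A =
    \<lparr> carrier = carrier A \<times> (if unital A then {0} else UNIV),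
      mult = (\<lambda>(a, r) (b, s).
        (a \<otimes>\<^bsub>A\<^esub> b \<oplus>\<^bsub>A\<^esub> (smult A r b \<oplus>\<^bsub>A\<^esub> smult A s a), r * s)),
      one = (if unital A then ((THE e. is_unit_of A e), 0) else (\<zero>\<^bsub>A\<^esub>, 1)),
      zero = (\<zero>\<^bsub>A\<^esub>, 0),
      add = (\<lambda>(a, r) (b, s). (a \<oplus>\<^bsub>A\<^esub> b, r + s)),
      smult = (\<lambda>c (a, r). (smult A c a, c * r)),
      star = (\<lambda>(a, r). (star A a, cnj r)),
      cnorm = (\<lambda>(a, r).
        (SUP b\<in>{b \<in> carrier A. cnorm A b \<le> 1}. cnorm A (a \<otimes>\<^bsub>A\<^esub> b \<oplus>\<^bsub>A\<^esub> smult A r b))) \<rparr>"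

definition self_module :: "'x cstar \<Rightarrow> ('x \<times> complex, 'x) hilbert_module" where
  "self_module A =
    \<lparr> m_carrier = carrier A,
      m_zero = \<zero>\<^bsub>A\<^esub>,
      m_add = (\<lambda>x y. x \<oplus>\<^bsub>A\<^esub> y),
      m_act = (\<lambda>x (a, r). x \<otimes>\<^bsub>A\<^esub> a \<oplus>\<^bsub>A\<^esub> smult A r x),
      m_inner = (\<lambda>x y. (star A x \<otimes>\<^bsub>A\<^esub> y, 0)) \<rparr>"

definition cstar_le :: "'x cstar \<Rightarrow> 'x \<Rightarrow> 'x \<Rightarrow> bool" where
  "cstar_le A a b \<longleftrightarrow> (\<exists>c\<in>carrier A. b \<ominus>\<^bsub>A\<^esub> a = star A c \<otimes>\<^bsub>A\<^esub> c)"


section \<open>The universal representation and the enveloping von Neumann algebra\<close>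

text \<open>In this section \<open>A\<close> is a unital C*-algebra.\<close>

definition states :: "'x cstar \<Rightarrow> ('x \<Rightarrow> complex) set" where
  "states A = {\<phi> \<in> extensional (carrier A).
     (\<forall>a\<in>carrier A. \<forall>b\<in>carrier A. \<phi> (a \<oplus>\<^bsub>A\<^esub> b) = \<phi> a + \<phi> b) \<and>
     (\<forall>c. \<forall>a\<in>carrier A. \<phi> (smult A c a) = c * \<phi> a) \<and>
     (\<forall>a\<in>carrier A. \<phi> (star A a \<otimes>\<^bsub>A\<^esub> a) \<in> \<real>\<^sub>\<ge>\<^sub>0) \<and>
     \<phi> \<one>\<^bsub>A\<^esub> = 1}"

text \<open>
  GNS space of a state \<open>\<phi>\<close>: the completion of \<open>A\<close> modulo the null space of the semi-inner
  product \<open>\<langle>a, b\<rangle> = \<phi>(a* b)\<close>. Its vectors are the classes of Cauchy sequences \<open>(a n)\<close>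
  in \<open>A\<close>; the class of \<open>(a n)\<close> is encoded by the function mapping \<open>b \<in> A\<close> to
  \<open>\<langle>b, a\<rangle> = lim \<phi>(b* (a n))\<close>. Two Cauchy sequences give the same function iff their
  difference is null, because the classes of the elements \<open>b\<close> are dense. With this
  encoding the vector space operations are pointwise.
\<close>

definition gns_Cauchy :: "'x cstar \<Rightarrow> ('x \<Rightarrow> complex) \<Rightarrow> (nat \<Rightarrow> 'x) \<Rightarrow> bool" where
  "gns_Cauchy A \<phi> a \<longleftrightarrow> range a \<subseteq> carrier A \<and>
     (\<forall>e>0. \<exists>N. \<forall>m\<ge>N. \<forall>n\<ge>N.
        Re (\<phi> (star A (a m \<ominus>\<^bsub>A\<^esub> a n) \<otimes>\<^bsub>A\<^esub> (a m \<ominus>\<^bsub>A\<^esub> a n))) < e)"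

definition gns_class :: "'x cstar \<Rightarrow> ('x \<Rightarrow> complex) \<Rightarrow> (nat \<Rightarrow> 'x) \<Rightarrow> 'x \<Rightarrow> complex" where
  "gns_class A \<phi> a =
     (\<lambda>b. if b \<in> carrier A then lim (\<lambda>n. \<phi> (star A b \<otimes>\<^bsub>A\<^esub> a n)) else 0)"

definition gns_space :: "'x cstar \<Rightarrow> ('x \<Rightarrow> complex) \<Rightarrow> ('x \<Rightarrow> complex) set" where
  "gns_space A \<phi> = {gns_class A \<phi> a | a. gns_Cauchy A \<phi> a}"

definition gns_inner ::
    "'x cstar \<Rightarrow> ('x \<Rightarrow> complex) \<Rightarrow> ('x \<Rightarrow> complex) \<Rightarrow> ('x \<Rightarrow> complex) \<Rightarrow> complex" where
  "gns_inner A \<phi> f g = (THE c. \<forall>a b.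
     gns_Cauchy A \<phi> a \<and> gns_class A \<phi> a = f \<and> gns_Cauchy A \<phi> b \<and> gns_class A \<phi> b = g \<longrightarrow>
     (\<lambda>n. \<phi> (star A (a n) \<otimes>\<^bsub>A\<^esub> b n)) \<longlonglongrightarrow> c)"

text \<open>
  The Hilbert space of the universal representation, i.e. the Hilbert space direct sum of the
  GNS spaces of all states. A vector is a family indexed by the states, extended by \<open>0\<close>.
\<close>

type_synonym 'x uvec = "('x \<Rightarrow> complex) \<Rightarrow> 'x \<Rightarrow> complex"

definition univ_space :: "'x cstar \<Rightarrow> 'x uvec set" where
  "univ_space A = {\<xi>.
     (\<forall>\<phi>\<in>states A. \<xi> \<phi> \<in> gns_space A \<phi>) \<and>
     (\<forall>\<phi>. \<phi> \<notin> states A \<longrightarrow> \<xi> \<phi> = (\<lambda>_. 0)) \<and>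
     (\<lambda>\<phi>. Re (gns_inner A \<phi> (\<xi> \<phi>) (\<xi> \<phi>))) summable_on states A}"

definition univ_inner :: "'x cstar \<Rightarrow> 'x uvec \<Rightarrow> 'x uvec \<Rightarrow> complex" where
  "univ_inner A \<xi> \<eta> = (\<Sum>\<^sub>\<infinity>\<phi>\<in>states A. gns_inner A \<phi> (\<xi> \<phi>) (\<eta> \<phi>))"

definition univ_norm :: "'x cstar \<Rightarrow> 'x uvec \<Rightarrow> real" where
  "univ_norm A \<xi> = sqrt (Re (univ_inner A \<xi> \<xi>))"

text \<open>
  An element \<open>a\<close> acts on each GNS space by mapping the class of \<open>(c n)\<close> to that of \<open>(a (c n))\<close>.
  As \<open>\<langle>b, a c\<rangle> = \<langle>a* b, c\<rangle>\<close>, in the encoding above this sends \<open>f\<close> to \<open>b \<mapsto> f (a* b)\<close>.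
\<close>

definition univ_rep :: "'x cstar \<Rightarrow> 'x \<Rightarrow> 'x uvec \<Rightarrow> 'x uvec" where
  "univ_rep A a = (\<lambda>\<xi>\<in>univ_space A. \<lambda>\<phi> b.
     if b \<in> carrier A then \<xi> \<phi> (star A a \<otimes>\<^bsub>A\<^esub> b) else 0)"

definition bounded_ops :: "'x cstar \<Rightarrow> ('x uvec \<Rightarrow> 'x uvec) set" where
  "bounded_ops A = {T \<in> univ_space A \<rightarrow>\<^sub>E univ_space A.
     (\<forall>\<xi>\<in>univ_space A. \<forall>\<eta>\<in>univ_space A.
        T (\<lambda>\<phi> b. \<xi> \<phi> b + \<eta> \<phi> b) = (\<lambda>\<phi> b. T \<xi> \<phi> b + T \<eta> \<phi> b)) \<and>
     (\<forall>c. \<forall>\<xi>\<in>univ_space A. T (\<lambda>\<phi> b. c * \<xi> \<phi> b) = (\<lambda>\<phi> b. c * T \<xi> \<phi> b)) \<and>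
     (\<exists>C. \<forall>\<xi>\<in>univ_space A. univ_norm A (T \<xi>) \<le> C * univ_norm A \<xi>)}"

definition commutant ::
    "'x cstar \<Rightarrow> ('x uvec \<Rightarrow> 'x uvec) set \<Rightarrow> ('x uvec \<Rightarrow> 'x uvec) set" where
  "commutant A M =
     {S \<in> bounded_ops A. \<forall>T\<in>M. \<forall>\<xi>\<in>univ_space A. S (T \<xi>) = T (S \<xi>)}"

definition enveloping_vN :: "'x cstar \<Rightarrow> ('x uvec \<Rightarrow> 'x uvec) set" where
  "enveloping_vN A = commutant A (commutant A (univ_rep A ` carrier A))"

definition op_le :: "'x cstar \<Rightarrow> ('x uvec \<Rightarrow> 'x uvec) \<Rightarrow> ('x uvec \<Rightarrow> 'x uvec) \<Rightarrow> bool" where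
  "op_le A S T \<longleftrightarrow>
     (\<forall>\<xi>\<in>univ_space A. univ_inner A \<xi> (T \<xi>) - univ_inner A \<xi> (S \<xi>) \<in> \<real>\<^sub>\<ge>\<^sub>0)"

text \<open>
  The ultraweak topology is the initial topology of the functionals
  \<open>S \<mapsto> \<Sum>n. \<langle>\<eta> n, S (\<xi> n)\<rangle>\<close> for square-summable sequences \<open>\<xi>\<close>, \<open>\<eta>\<close> of vectors, so
  convergence in it is convergence of all these functionals.
\<close>

definition square_summable :: "'x cstar \<Rightarrow> (nat \<Rightarrow> 'x uvec) \<Rightarrow> bool" where
  "square_summable A \<xi> \<longleftrightarrow>
     range \<xi> \<subseteq> univ_space A \<and> summable (\<lambda>n. (univ_norm A (\<xi> n))\<^sup>2)"

definition ultraweak_tendsto ::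
    "'x cstar \<Rightarrow> ('i \<Rightarrow> 'x uvec \<Rightarrow> 'x uvec) \<Rightarrow> ('x uvec \<Rightarrow> 'x uvec) \<Rightarrow> 'i filter \<Rightarrow> bool" where
  "ultraweak_tendsto A S T F \<longleftrightarrow>
     (\<forall>\<xi> \<eta>. square_summable A \<xi> \<and> square_summable A \<eta> \<longrightarrow>
        ((\<lambda>i. \<Sum>n. univ_inner A (\<eta> n) (S i (\<xi> n)))
           \<longlongrightarrow> (\<Sum>n. univ_inner A (\<eta> n) (T (\<xi> n)))) F)"


section \<open>Frames\<close>

text \<open>
  \<open>A\<close> is a unital C*-algebra and \<open>N\<close> a Hilbert module over it. The series are limits of the
  net of all finite partial sums.
\<close>

definition frame_partial_sum ::
    "'x cstar \<Rightarrow> ('x, 'n) hilbert_module \<Rightarrow> ('j \<Rightarrow> 'n) \<Rightarrow> 'n \<Rightarrow> 'j set \<Rightarrow> 'x" where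
  "frame_partial_sum A N x y F =
     (\<Oplus>\<^bsub>A\<^esub>j\<in>F. m_inner N y (x j) \<otimes>\<^bsub>A\<^esub> m_inner N (x j) y)"

definition standard_frame ::
    "'x cstar \<Rightarrow> ('x, 'n) hilbert_module \<Rightarrow> 'j set \<Rightarrow> ('j \<Rightarrow> 'n) \<Rightarrow> bool" where
  "standard_frame A N J x \<longleftrightarrow> x ` J \<subseteq> m_carrier N \<and>
     (\<exists>c\<^sub>1>0::real. \<exists>c\<^sub>2>0::real. \<forall>y\<in>m_carrier N. \<exists>s\<in>carrier A.
        ((\<lambda>F. cnorm A (frame_partial_sum A N x y F \<ominus>\<^bsub>A\<^esub> s)) \<longlongrightarrow> 0)
          (finite_subsets_at_top J) \<and>
        cstar_le A (smult A (of_real c\<^sub>1) (m_inner N y y)) s \<and>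
        cstar_le A s (smult A (of_real c\<^sub>2) (m_inner N y y)))"

definition nonstandard_frame ::
    "'x cstar \<Rightarrow> ('x, 'n) hilbert_module \<Rightarrow> 'j set \<Rightarrow> ('j \<Rightarrow> 'n) \<Rightarrow> bool" where
  "nonstandard_frame A N J x \<longleftrightarrow> x ` J \<subseteq> m_carrier N \<and>
     (\<exists>c\<^sub>1>0::real. \<exists>c\<^sub>2>0::real. \<forall>y\<in>m_carrier N. \<exists>T\<in>enveloping_vN A.
        ultraweak_tendsto A (\<lambda>F. univ_rep A (frame_partial_sum A N x y F)) T
          (finite_subsets_at_top J) \<and>
        op_le A (univ_rep A (smult A (of_real c\<^sub>1) (m_inner N y y))) T \<and>
        op_le A T (univ_rep A (smult A (of_real c\<^sub>2) (m_inner N y y))))"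

definition is_frame ::
    "'x cstar \<Rightarrow> ('x, 'n) hilbert_module \<Rightarrow> 'j set \<Rightarrow> ('j \<Rightarrow> 'n) \<Rightarrow> bool" where
  "is_frame A N J x \<longleftrightarrow> standard_frame A N J x \<or> nonstandard_frame A N J x"


section \<open>The algebra of functions vanishing at infinity\<close>

definition sigma_compactin :: "'a topology \<Rightarrow> 'a set \<Rightarrow> bool" where
  "sigma_compactin K S \<longleftrightarrow> (\<exists>\<C>. countable \<C> \<and> (\<forall>C\<in>\<C>. compactin K C) \<and> S = \<Union>\<C>)"

text \<open>
  Functions on the space \<open>K\<close> are extended by \<open>0\<close> outside \<open>topspace K\<close>; this makes all
  operations pointwise, and the supremum in the norm may range over the whole type.
\<close>

definition C0 :: "'a topology \<Rightarrow> ('a \<Rightarrow> complex) cstar" where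
  "C0 K =
    \<lparr> carrier = {f. continuous_map K euclidean f \<and> (\<forall>t. t \<notin> topspace K \<longrightarrow> f t = 0) \<and>
        (\<forall>e>0. \<exists>C. compactin K C \<and> (\<forall>t\<in>topspace K - C. cmod (f t) < e))},
      mult = (\<lambda>f g t. f t * g t),
      one = (\<lambda>t. if t \<in> topspace K then 1 else 0),
      zero = (\<lambda>t. 0),
      add = (\<lambda>f g t. f t + g t),
      smult = (\<lambda>c f t. c * f t),
      star = (\<lambda>f t. cnj (f t)),
      cnorm = (\<lambda>f. SUP t. cmod (f t)) \<rparr>"

end

theory Submission
  imports Defs
begin

text \<open>
  Every point \<open>t\<close> of \<open>K\<close> gives a character of the unitalization, and the class of \<open>1\<close> in its
  GNS space is a vector of the universal representation. Hence even ultraweak convergence of the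
  frame series can be tested at \<open>t\<close>: the numbers \<open>|x j t|\<^sup>2\<close> have a finite sum, bounded below by
  the positive lower frame constant. A convergent sum has only countably many nonzero terms, so
  at the points of a countable dense set only countably many of the \<open>x j\<close> are nonzero, and the
  other \<open>x j\<close> vanish identically by continuity. A function vanishing at infinity is nonzero only
  on a \<open>\<sigma>\<close>-compact set, and since every \<open>t\<close> is in one of these countably many sets, \<open>K\<close> would be
  \<open>\<sigma>\<close>-compact.
\<close>

section \<open>Sums with at most one nonzero term\<close>

lemma summable_on_single_index:
  fixes f :: "'b \<Rightarrow> 'c::{comm_monoid_add, topological_space}"
  assumes "\<And>x. x \<in> S \<Longrightarrow> x \<noteq> a \<Longrightarrow> f x = 0"
  shows "f summable_on S"
  by (rule finite_nonzero_values_imp_summable_on, rule finite_subset[of _ "{a}"])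
     (use assms in auto)

lemma infsum_single_index:
  fixes f :: "'b \<Rightarrow> 'c::{comm_monoid_add, t2_space}"
  assumes "a \<in> S" "\<And>x. x \<in> S \<Longrightarrow> x \<noteq> a \<Longrightarrow> f x = 0"
  shows "infsum f S = f a"
proof -
  have "infsum f S = infsum f {a}"
    by (rule infsum_cong_neutral) (use assms in auto)
  then show ?thesis by simp
qed

section \<open>Characters in the universal representation\<close>

locale star_algebra = ring A for A :: "'x cstar" (structure) +
  assumes smult_closed [simp, intro]: "a \<in> carrier A \<Longrightarrow> smult A c a \<in> carrier A"
    and smult_mult_left: "\<lbrakk>a \<in> carrier A; b \<in> carrier A\<rbrakk> \<Longrightarrow> smult A c a \<otimes> b = smult A c (a \<otimes> b)"
    and smult_mult_right: "\<lbrakk>a \<in> carrier A; b \<in> carrier A\<rbrakk> \<Longrightarrow> a \<otimes> smult A c b = smult A c (a \<otimes> b)"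
    and star_closed [simp, intro]: "a \<in> carrier A \<Longrightarrow> star A a \<in> carrier A"
    and star_add: "\<lbrakk>a \<in> carrier A; b \<in> carrier A\<rbrakk> \<Longrightarrow> star A (a \<oplus> b) = star A a \<oplus> star A b"
    and star_smult: "a \<in> carrier A \<Longrightarrow> star A (smult A c a) = smult A (cnj c) (star A a)"
    and smult_neg_one: "a \<in> carrier A \<Longrightarrow> smult A (-1) a = \<ominus> a"

locale star_algebra_state = star_algebra A for A :: "'x cstar" (structure) +
  fixes \<phi> :: "'x \<Rightarrow> complex"
  assumes state: "\<phi> \<in> states A"
begin

lemma phi_add: "\<lbrakk>a \<in> carrier A; b \<in> carrier A\<rbrakk> \<Longrightarrow> \<phi> (a \<oplus> b) = \<phi> a + \<phi> b"
  and phi_smult: "a \<in> carrier A \<Longrightarrow> \<phi> (smult A c a) = c * \<phi> a"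
  and phi_nonneg: "a \<in> carrier A \<Longrightarrow> \<phi> (star A a \<otimes> a) \<in> \<real>\<^sub>\<ge>\<^sub>0"
  and phi_one: "\<phi> \<one> = 1"
  using state by (auto simp: states_def)

lemma phi_zero: "\<phi> \<zero> = 0"
  using phi_add[of \<zero> \<zero>] by simp

lemma phi_minus: "\<lbrakk>a \<in> carrier A; b \<in> carrier A\<rbrakk> \<Longrightarrow> \<phi> (a \<ominus> b) = \<phi> a - \<phi> b"
  by (simp add: minus_eq phi_add phi_smult flip: smult_neg_one)

lemma phi_finsum:
  assumes "finite F" "f \<in> F \<rightarrow> carrier A"
  shows "\<phi> (finsum A f F) = (\<Sum>j\<in>F. \<phi> (f j))"
  using assms by induction (auto simp: phi_zero phi_add Pi_def finsum_closed)

text \<open>The scalar \<open>z\<close> stays free: specialising it to \<open>1\<close>,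
  \<open>-1\<close>, \<open>\<i>\<close>, \<open>-\<i>\<close> yields hermitian symmetry and the
  bound of Cauchy-Schwarz type below.\<close>

lemma form_add:
  assumes "a \<in> carrier A" "b \<in> carrier A"
  shows "\<phi> (star A (a \<oplus> smult A z b) \<otimes> (a \<oplus> smult A z b)) =
     \<phi> (star A a \<otimes> a) + z * \<phi> (star A a \<otimes> b) + cnj z * \<phi> (star A b \<otimes> a)
       + cnj z * z * \<phi> (star A b \<otimes> b)"
  using assms
  by (simp add: star_add star_smult l_distr r_distr smult_mult_left smult_mult_right
      phi_add phi_smult ring_distribs mult.assoc)

text \<open>Positivity makes diagonal values real, so the cross terms of \<open>form_add\<close> add
  up to a real number for each \<open>z\<close>; \<open>z = 1\<close> settles the imaginary parts
  and \<open>z = \<i>\<close> the real parts.\<close>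

lemma form_hermitian:
  assumes "a \<in> carrier A" "b \<in> carrier A"
  shows "\<phi> (star A b \<otimes> a) = cnj (\<phi> (star A a \<otimes> b))"
proof -
  have im: "Im (\<phi> (star A c \<otimes> c)) = 0" if "c \<in> carrier A" for c
    using phi_nonneg[OF that] by (auto simp: complex_nonneg_Reals_iff)
  have "Im (z * \<phi> (star A a \<otimes> b) + cnj z * \<phi> (star A b \<otimes> a)) = 0" for z
    using im[of "a \<oplus> smult A z b"] im[of a] im[of b] assms
    by (simp add: form_add)
  from this[of 1] this[of \<i>] show ?thesis
    by (auto simp: complex_eq_iff)
qed

lemma form_minus:
  assumes "a \<in> carrier A" "b \<in> carrier A"
  shows "Re (\<phi> (star A (a \<ominus> b) \<otimes> (a \<ominus> b))) =
     Re (\<phi> (star A a \<otimes> a)) - 2 * Re (\<phi> (star A b \<otimes> a)) + Re (\<phi> (star A b \<otimes> b))"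
  using form_add[OF assms, of "-1"] form_hermitian[OF assms] assms
  by (simp add: minus_eq smult_neg_one)

text \<open>A substitute for Cauchy-Schwarz. Positivity at \<open>z = 1\<close>, \<open>-1\<close>
  bounds twice the absolute real part by the right-hand side, at \<open>z = \<i>\<close>,
  \<open>-\<i>\<close> twice the absolute imaginary part; the modulus is at most the sum of the two
  absolute parts.\<close>

lemma form_bound:
  assumes "a \<in> carrier A" "b \<in> carrier A"
  shows "cmod (\<phi> (star A a \<otimes> b)) \<le> Re (\<phi> (star A a \<otimes> a)) + Re (\<phi> (star A b \<otimes> b))"
proof -
  have "0 \<le> Re (\<phi> (star A a \<otimes> a)) + 2 * Re (z * \<phi> (star A a \<otimes> b)) +
      (cmod z)\<^sup>2 * Re (\<phi> (star A b \<otimes> b))" for z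
    using phi_nonneg[of "a \<oplus> smult A z b"] form_hermitian[OF assms] assms
    by (simp add: form_add complex_nonneg_Reals_iff cmod_def power2_eq_square algebra_simps)
  from this[of 1] this[of "-1"] this[of \<i>] this[of "-\<i>"]
  show ?thesis
    using cmod_le[of "\<phi> (star A a \<otimes> b)"] by simp
qed

text \<open>The weight \<open>d\<close> makes up for the missing homogeneity of
  \<open>form_bound\<close>: after division by \<open>d\<close>, the term in \<open>a\<close> is
  small for small \<open>d\<close>.\<close>

lemma form_scaled_bound:
  assumes "a \<in> carrier A" "b \<in> carrier A" "0 \<le> d"
  shows "d * cmod (\<phi> (star A a \<otimes> b)) \<le> d\<^sup>2 * Re (\<phi> (star A a \<otimes> a)) + Re (\<phi> (star A b \<otimes> b))"
  using form_bound[of "smult A (of_real d) a" b] assms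
  by (simp add: star_smult smult_mult_left smult_mult_right phi_smult norm_mult power2_eq_square
      mult.assoc)

section \<open>Cauchy sequences and vectors of the GNS space\<close>

lemma gns_Cauchy_const: "a \<in> carrier A \<Longrightarrow> gns_Cauchy A \<phi> (\<lambda>_. a)"
  by (auto simp: gns_Cauchy_def minus_eq r_neg phi_zero)

lemma gns_Cauchy_closed: "gns_Cauchy A \<phi> a \<Longrightarrow> a n \<in> carrier A"
  by (auto simp: gns_Cauchy_def)

text \<open>\<open>gns_class\<close> is written with \<open>lim\<close>, which is informative only
  for convergent sequences. Pairing with a fixed \<open>b\<close> is bounded in the seminorm, so it
  preserves Cauchy sequences.\<close>

lemma gns_Cauchy_convergent:
  assumes a: "gns_Cauchy A \<phi> a" and b: "b \<in> carrier A"
  shows "convergent (\<lambda>n. \<phi> (star A b \<otimes> a n))"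
proof -
  note ac = gns_Cauchy_closed[OF a]
  \<comment> \<open>The summand \<open>1\<close> keeps \<open>B\<close> positive even if
    \<open>b\<close> is a null vector.\<close>
  define B where "B = Re (\<phi> (star A b \<otimes> b)) + 1"
  have B: "B > 0"
    using phi_nonneg[OF b] by (simp add: B_def complex_nonneg_Reals_iff)
  have "Cauchy (\<lambda>n. \<phi> (star A b \<otimes> a n))"
  proof (rule CauchyI)
    fix e :: real
    assume e: "0 < e"
    \<comment> \<open>Chosen so that \<open>d\<^sup>2 * B = d * e / 2\<close>; the Cauchy condition
      supplies the other \<open>d * e / 2\<close>, and then \<open>d\<close> cancels.\<close>
    define d where "d = e / (2 * B)"
    have d: "d > 0" using e B by (simp add: d_def)
    then obtain N where N: "\<And>m n. m \<ge> N \<Longrightarrow> n \<ge> N \<Longrightarrow>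
        Re (\<phi> (star A (a m \<ominus> a n) \<otimes> (a m \<ominus> a n))) < d * e / 2"
      using a e unfolding gns_Cauchy_def by (metis half_gt_zero mult_pos_pos)
    have "cmod (\<phi> (star A b \<otimes> a m) - \<phi> (star A b \<otimes> a n)) < e" if "m \<ge> N" "n \<ge> N" for m n
    proof -
      have eq: "\<phi> (star A b \<otimes> a m) - \<phi> (star A b \<otimes> a n) = \<phi> (star A b \<otimes> (a m \<ominus> a n))"
        using ac b by (simp add: phi_minus[symmetric]) (simp add: minus_eq r_distr r_minus)
      have "d * cmod (\<phi> (star A b \<otimes> (a m \<ominus> a n))) \<le> d\<^sup>2 * Re (\<phi> (star A b \<otimes> b)) +
          Re (\<phi> (star A (a m \<ominus> a n) \<otimes> (a m \<ominus> a n)))"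
        by (rule form_scaled_bound) (use ac b d in auto)
      also have "\<dots> < d\<^sup>2 * B + d * e / 2"
        using N[OF that] d by (simp add: B_def add_le_less_mono)
      also have "\<dots> = d * e"
        using B by (simp add: d_def power2_eq_square field_simps)
      finally show ?thesis
        using d by (simp add: eq)
    qed
    then show "\<exists>M. \<forall>m\<ge>M. \<forall>n\<ge>M. norm (\<phi> (star A b \<otimes> a m) - \<phi> (star A b \<otimes> a n)) < e"
      by blast
  qed
  then show ?thesis
    by (rule Cauchy_convergent)
qed

lemma gns_class_LIMSEQ:
  assumes "gns_Cauchy A \<phi> a" "b \<in> carrier A"
  shows "(\<lambda>n. \<phi> (star A b \<otimes> a n)) \<longlonglongrightarrow> gns_class A \<phi> a b"
  using gns_Cauchy_convergent[OF assms] assms(2)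
  by (simp add: gns_class_def convergent_LIMSEQ_iff)

lemma gns_class_zero: "gns_class A \<phi> (\<lambda>_. \<zero>) = (\<lambda>_. 0)"
  by (auto simp: gns_class_def phi_zero fun_eq_iff)

text \<open>A Cauchy sequence that tends weakly to zero tends to zero in seminorm: expand the form
  at \<open>a n \<ominus> a N\<close> with \<open>N\<close> fixed; the whole is small by the Cauchy
  condition and the cross term by weak convergence.\<close>

lemma gns_null_form_LIMSEQ:
  assumes a: "gns_Cauchy A \<phi> a" and null: "gns_class A \<phi> a = (\<lambda>_. 0)"
  shows "(\<lambda>n. Re (\<phi> (star A (a n) \<otimes> a n))) \<longlonglongrightarrow> 0"
proof (rule LIMSEQ_I)
  note ac = gns_Cauchy_closed[OF a]
  fix e :: real
  assume e: "0 < e"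
  obtain N where N: "\<And>m n. m \<ge> N \<Longrightarrow> n \<ge> N \<Longrightarrow>
      Re (\<phi> (star A (a m \<ominus> a n) \<otimes> (a m \<ominus> a n))) < e / 2"
    using a e unfolding gns_Cauchy_def by (metis half_gt_zero)
  have "(\<lambda>n. \<phi> (star A (a N) \<otimes> a n)) \<longlonglongrightarrow> 0"
    using gns_class_LIMSEQ[OF a ac[of N]] null by simp
  then obtain M where M: "\<And>n. n \<ge> M \<Longrightarrow> cmod (\<phi> (star A (a N) \<otimes> a n)) < e / 4"
    using LIMSEQ_D[of _ 0 "e / 4"] e by fastforce
  have "norm (Re (\<phi> (star A (a n) \<otimes> a n)) - 0) < e" if "n \<ge> max M N" for n
  proof -
    have "Re (\<phi> (star A (a n) \<otimes> a n)) - 2 * Re (\<phi> (star A (a N) \<otimes> a n)) < e / 2"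
      using N[of n N] that form_minus[of "a n" "a N"] ac phi_nonneg[of "a N"]
      by (auto simp: complex_nonneg_Reals_iff)
    moreover have "Re (\<phi> (star A (a N) \<otimes> a n)) < e / 4"
      using M[of n] that complex_Re_le_cmod[of "\<phi> (star A (a N) \<otimes> a n)"] by simp
    ultimately show ?thesis
      using phi_nonneg[of "a n"] ac by (auto simp: complex_nonneg_Reals_iff)
  qed
  then show "\<exists>no. \<forall>n\<ge>no. norm (Re (\<phi> (star A (a n) \<otimes> a n)) - 0) < e"
    by blast
qed

text \<open>\<open>gns_inner\<close> is a definite description over all representing sequences.
  Representatives of the zero vector are null in seminorm, so \<open>0\<close> qualifies; the
  constant sequence \<open>\<zero>\<close> is one of them, so no other value does.\<close>

lemma gns_inner_zero: "gns_inner A \<phi> (\<lambda>_. 0) (\<lambda>_. 0) = 0"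
  unfolding gns_inner_def
proof (rule the_equality)
  show "\<forall>a b. gns_Cauchy A \<phi> a \<and> gns_class A \<phi> a = (\<lambda>_. 0) \<and> gns_Cauchy A \<phi> b \<and>
      gns_class A \<phi> b = (\<lambda>_. 0) \<longrightarrow> (\<lambda>n. \<phi> (star A (a n) \<otimes> b n)) \<longlonglongrightarrow> 0"
  proof (intro allI impI, elim conjE)
    fix a b
    assume a: "gns_Cauchy A \<phi> a" "gns_class A \<phi> a = (\<lambda>_. 0)"
      and b: "gns_Cauchy A \<phi> b" "gns_class A \<phi> b = (\<lambda>_. 0)"
    show "(\<lambda>n. \<phi> (star A (a n) \<otimes> b n)) \<longlonglongrightarrow> 0"
    proof (rule Lim_null_comparison)
      show "(\<lambda>n. Re (\<phi> (star A (a n) \<otimes> a n)) + Re (\<phi> (star A (b n) \<otimes> b n))) \<longlonglongrightarrow> 0"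
        using tendsto_add[OF gns_null_form_LIMSEQ[OF a] gns_null_form_LIMSEQ[OF b]] by simp
    qed (auto intro!: always_eventually form_bound gns_Cauchy_closed a b)
  qed
next
  fix c
  assume "\<forall>a b. gns_Cauchy A \<phi> a \<and> gns_class A \<phi> a = (\<lambda>_. 0) \<and> gns_Cauchy A \<phi> b \<and>
      gns_class A \<phi> b = (\<lambda>_. 0) \<longrightarrow> (\<lambda>n. \<phi> (star A (a n) \<otimes> b n)) \<longlonglongrightarrow> c"
  then have "(\<lambda>n. \<phi> (star A \<zero> \<otimes> \<zero>)) \<longlonglongrightarrow> c"
    using gns_class_zero gns_Cauchy_const[OF zero_closed] by blast
  then show "c = 0"
    by (simp add: phi_zero LIMSEQ_const_iff)
qed

lemma zero_in_gns_space: "(\<lambda>_. 0) \<in> gns_space A \<phi>"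
  using gns_class_zero[symmetric] gns_Cauchy_const[OF zero_closed]
  unfolding gns_space_def by blast

end

section \<open>Characters as vectors of the universal representation\<close>

locale star_algebra_character = star_algebra_state A \<omega>
  for A :: "'x cstar" (structure) and \<omega> :: "'x \<Rightarrow> complex" +
  assumes omega_mult: "\<lbrakk>a \<in> carrier A; b \<in> carrier A\<rbrakk> \<Longrightarrow> \<omega> (a \<otimes> b) = \<omega> a * \<omega> b"
    and omega_star: "a \<in> carrier A \<Longrightarrow> \<omega> (star A a) = cnj (\<omega> a)"
begin

text \<open>The class of \<open>k 1\<close> in the one-dimensional GNS space of \<open>\<omega>\<close>.\<close>

definition char_vec :: "complex \<Rightarrow> 'x uvec" where
  "char_vec k = (\<lambda>\<phi> b. if \<phi> = \<omega> \<and> b \<in> carrier A then k * cnj (\<omega> b) else 0)"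

text \<open>By multiplicativity the class of a constant sequence depends only on the value of
  \<open>\<omega>\<close>. Multiples of the unit realise every scalar, so each
  \<open>char_vec k \<omega>\<close> is a GNS vector.\<close>

lemma char_vec_const: "char_vec (\<omega> a) \<omega> = gns_class A \<omega> (\<lambda>_. a)" if "a \<in> carrier A"
  using that by (auto simp: char_vec_def gns_class_def omega_mult omega_star fun_eq_iff)

lemma gns_class_eq_char_vec:
  assumes a: "gns_Cauchy A \<omega> a" and eq: "gns_class A \<omega> a = char_vec k \<omega>"
  shows "(\<lambda>n. \<omega> (a n)) \<longlonglongrightarrow> k"
proof -
  have "(\<lambda>n. \<omega> (star A \<one> \<otimes> a n)) \<longlonglongrightarrow> char_vec k \<omega> \<one>"
    using gns_class_LIMSEQ[OF a one_closed] eq by simp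
  then show ?thesis
    using gns_Cauchy_closed[OF a] by (simp add: omega_mult omega_star phi_one char_vec_def)
qed

lemma gns_inner_char_vec: "gns_inner A \<omega> (char_vec k \<omega>) (char_vec l \<omega>) = cnj k * l"
  unfolding gns_inner_def
proof (rule the_equality)
  show "\<forall>a b. gns_Cauchy A \<omega> a \<and> gns_class A \<omega> a = char_vec k \<omega> \<and> gns_Cauchy A \<omega> b \<and>
      gns_class A \<omega> b = char_vec l \<omega> \<longrightarrow> (\<lambda>n. \<omega> (star A (a n) \<otimes> b n)) \<longlonglongrightarrow> cnj k * l"
    by (auto simp: omega_mult omega_star gns_Cauchy_closed
        intro!: tendsto_mult tendsto_cnj gns_class_eq_char_vec)
next
  fix c
  assume *: "\<forall>a b. gns_Cauchy A \<omega> a \<and> gns_class A \<omega> a = char_vec k \<omega> \<and> gns_Cauchy A \<omega> b \<and>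
      gns_class A \<omega> b = char_vec l \<omega> \<longrightarrow> (\<lambda>n. \<omega> (star A (a n) \<otimes> b n)) \<longlonglongrightarrow> c"
  \<comment> \<open>Uniqueness needs representatives of both vectors: constant sequences of
    multiples of the unit.\<close>
  have const: "smult A z \<one> \<in> carrier A" "\<omega> (smult A z \<one>) = z" for z
    by (auto simp: phi_smult phi_one)
  have "(\<lambda>n::nat. \<omega> (star A (smult A k \<one>) \<otimes> smult A l \<one>)) \<longlonglongrightarrow> c"
    using *[rule_format, of "\<lambda>_. smult A k \<one>" "\<lambda>_. smult A l \<one>"]
      gns_Cauchy_const[OF const(1)] char_vec_const[OF const(1)] const by simp
  then show "c = cnj k * l"
    using const by (simp add: omega_mult omega_star LIMSEQ_const_iff)
qed

lemma char_vec_other: "\<phi> \<noteq> \<omega> \<Longrightarrow> char_vec k \<phi> = (\<lambda>_. 0)"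
  by (auto simp: char_vec_def)

lemma gns_inner_char_vec_other:
  assumes "\<phi> \<in> states A" "\<phi> \<noteq> \<omega>"
  shows "gns_inner A \<phi> (char_vec k \<phi>) (char_vec l \<phi>) = 0"
proof -
  interpret \<phi>: star_algebra_state A \<phi>
    by unfold_locales fact
  show ?thesis
    using assms by (simp add: char_vec_other \<phi>.gns_inner_zero)
qed

text \<open>The family of components over all states is nonzero at most at \<open>\<omega>\<close>,
  so its square-summability is trivial.\<close>

lemma char_vec_in_univ_space: "char_vec k \<in> univ_space A"
proof -
  have "char_vec k \<omega> \<in> gns_space A \<omega>"
    using char_vec_const[of "smult A k \<one>"] gns_Cauchy_const[of "smult A k \<one>"]
    by (auto simp: phi_smult phi_one gns_space_def)
  moreover have "char_vec k \<phi> \<in> gns_space A \<phi>" if "\<phi> \<in> states A" "\<phi> \<noteq> \<omega>" for \<phi>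
  proof -
    interpret \<phi>: star_algebra_state A \<phi>
      by unfold_locales fact
    show ?thesis
      using that by (simp add: char_vec_other \<phi>.zero_in_gns_space)
  qed
  moreover have "(\<lambda>\<phi>. Re (gns_inner A \<phi> (char_vec k \<phi>) (char_vec k \<phi>))) summable_on states A"
    by (rule summable_on_single_index[of _ \<omega>]) (simp add: gns_inner_char_vec_other)
  moreover have "char_vec k \<phi> = (\<lambda>_. 0)" if "\<phi> \<notin> states A" for \<phi>
    using that state by (intro char_vec_other) auto
  ultimately show ?thesis
    unfolding univ_space_def mem_Collect_eq by blast
qed

lemma univ_inner_char_vec: "univ_inner A (char_vec k) (char_vec l) = cnj k * l"
  unfolding univ_inner_def
  by (subst infsum_single_index[of \<omega>])
     (auto simp: state gns_inner_char_vec gns_inner_char_vec_other)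

text \<open>These vectors are common eigenvectors of the represented algebra, which turns matrix
  coefficients into values of \<open>\<omega>\<close>.\<close>

lemma univ_rep_char_vec:
  assumes "a \<in> carrier A"
  shows "univ_rep A a (char_vec k) = char_vec (\<omega> a * k)"
  using assms char_vec_in_univ_space
  by (auto simp: univ_rep_def char_vec_def omega_mult omega_star fun_eq_iff)

lemma char_vec_zero: "char_vec 0 = (\<lambda>_ _. 0)"
  by (auto simp: char_vec_def fun_eq_iff)

text \<open>Test against the square-summable sequence whose only nonzero term is the class of \<open>1\<close>.\<close>

lemma ultraweak_tendsto_character:
  assumes T: "T \<in> bounded_ops A"
    and lim: "ultraweak_tendsto A (\<lambda>i. univ_rep A (s i)) T F"
    and s: "\<forall>\<^sub>F i in F. s i \<in> carrier A"
  shows "((\<lambda>i. \<omega> (s i)) \<longlongrightarrow> univ_inner A (char_vec 1) (T (char_vec 1))) F"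
proof -
  define \<xi> where "\<xi> n = char_vec (if n = 0 then 1 else 0)" for n :: nat
  have norm: "univ_norm A (\<xi> n) = (if n = 0 then 1 else 0)" for n
    by (simp add: \<xi>_def univ_norm_def univ_inner_char_vec)
  have "square_summable A \<xi>"
    unfolding square_summable_def norm
    by (auto simp: \<xi>_def char_vec_in_univ_space intro!: summable_finite[of "{0}"] split: if_splits)
  then have lim': "((\<lambda>i. \<Sum>n. univ_inner A (\<xi> n) (univ_rep A (s i) (\<xi> n)))
      \<longlongrightarrow> (\<Sum>n. univ_inner A (\<xi> n) (T (\<xi> n)))) F"
    using lim by (simp add: ultraweak_tendsto_def)
  \<comment> \<open>Homogeneity with scalar \<open>0\<close> gives \<open>T 0 = 0\<close>, which
    removes every term of the limit series except the first.\<close>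
  have zero: "T (char_vec 0) = char_vec 0"
  proof -
    have "T (\<lambda>\<phi> b. 0 * char_vec 0 \<phi> b) = (\<lambda>\<phi> b. 0 * T (char_vec 0) \<phi> b)"
      using T char_vec_in_univ_space unfolding bounded_ops_def by blast
    then show ?thesis
      by (simp add: char_vec_zero)
  qed
  have "(\<Sum>n. univ_inner A (\<xi> n) (T (\<xi> n))) = (\<Sum>n\<in>{0}. univ_inner A (\<xi> n) (T (\<xi> n)))"
    by (rule suminf_finite) (auto simp: \<xi>_def zero univ_inner_char_vec)
  moreover have "(\<Sum>n. univ_inner A (\<xi> n) (univ_rep A (s i) (\<xi> n))) = \<omega> (s i)"
    if "s i \<in> carrier A" for i
    using that by (subst suminf_finite[of "{0}"])
      (auto simp: \<xi>_def univ_rep_char_vec univ_inner_char_vec)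
  ultimately show ?thesis
    using lim' s by (auto simp: \<xi>_def elim!: Lim_transform_eventually eventually_mono)
qed

lemma op_le_character:
  assumes "op_le A (univ_rep A a) T" "a \<in> carrier A"
  shows "univ_inner A (char_vec 1) (T (char_vec 1)) - \<omega> a \<in> \<real>\<^sub>\<ge>\<^sub>0"
  using assms char_vec_in_univ_space[of 1]
  by (auto simp: op_le_def univ_rep_char_vec univ_inner_char_vec)

lemma cstar_le_character:
  assumes "cstar_le A a b" "a \<in> carrier A" "b \<in> carrier A"
  shows "\<omega> b - \<omega> a \<in> \<real>\<^sub>\<ge>\<^sub>0"
  using assms phi_nonneg by (auto simp: cstar_le_def simp flip: phi_minus)

end

section \<open>The function algebra and its unitalization\<close>

lemma C0_simps [simp]:
  "f \<otimes>\<^bsub>C0 K\<^esub> g = (\<lambda>t. f t * g t)" "\<one>\<^bsub>C0 K\<^esub> = (\<lambda>t. if t \<in> topspace K then 1 else 0)"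
  "\<zero>\<^bsub>C0 K\<^esub> = (\<lambda>t. 0)" "f \<oplus>\<^bsub>C0 K\<^esub> g = (\<lambda>t. f t + g t)"
  "smult (C0 K) c f = (\<lambda>t. c * f t)" "star (C0 K) f = (\<lambda>t. cnj (f t))"
  "cnorm (C0 K) f = (SUP t. cmod (f t))"
  by (auto simp: C0_def)

lemma C0_memI:
  assumes "continuous_map K euclidean f" "\<And>t. t \<notin> topspace K \<Longrightarrow> f t = 0"
    and "\<And>e. e > 0 \<Longrightarrow> \<exists>C. compactin K C \<and> (\<forall>t\<in>topspace K - C. cmod (f t) < e)"
  shows "f \<in> carrier (C0 K)"
  using assms by (auto simp: C0_def)

lemma C0_continuous: "f \<in> carrier (C0 K) \<Longrightarrow> continuous_map K euclidean f"
  and C0_outside: "f \<in> carrier (C0 K) \<Longrightarrow> t \<notin> topspace K \<Longrightarrow> f t = 0"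
  and C0_vanishing: "f \<in> carrier (C0 K) \<Longrightarrow> e > 0 \<Longrightarrow>
     \<exists>C. compactin K C \<and> (\<forall>t\<in>topspace K - C. cmod (f t) < e)"
  by (auto simp: C0_def)

lemma C0_zero: "(\<lambda>t. 0) \<in> carrier (C0 K)"
  by (rule C0_memI) (auto intro!: exI[of _ "{}"])

lemma C0_add:
  assumes f: "f \<in> carrier (C0 K)" and g: "g \<in> carrier (C0 K)"
  shows "(\<lambda>t. f t + g t) \<in> carrier (C0 K)"
proof (rule C0_memI)
  show "continuous_map K euclidean (\<lambda>t. f t + g t)"
    by (intro continuous_map_add C0_continuous f g)
  show "f t + g t = 0" if "t \<notin> topspace K" for t
    using that f g by (simp add: C0_outside)
  fix e :: real
  assume "e > 0"
  then obtain C D where C: "compactin K C" "\<forall>t\<in>topspace K - C. cmod (f t) < e / 2"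
    and D: "compactin K D" "\<forall>t\<in>topspace K - D. cmod (g t) < e / 2"
    using C0_vanishing[OF f, of "e / 2"] C0_vanishing[OF g, of "e / 2"] by auto
  have "\<forall>t\<in>topspace K - (C \<union> D). cmod (f t + g t) < e"
    using C(2) D(2) by (metis DiffE DiffI UnCI norm_add_less field_sum_of_halves)
  then show "\<exists>C. compactin K C \<and> (\<forall>t\<in>topspace K - C. cmod (f t + g t) < e)"
    using compactin_Un[OF C(1) D(1)] by blast
qed

lemma C0_bounded:
  assumes f: "f \<in> carrier (C0 K)"
  obtains M where "M > 0" "\<And>t. cmod (f t) \<le> M"
proof -
  obtain C where C: "compactin K C" "\<forall>t\<in>topspace K - C. cmod (f t) < 1"
    using C0_vanishing[OF f, of 1] by auto
  have "compactin euclidean (f ` C)"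
    using image_compactin[OF C(1) C0_continuous[OF f]] .
  then have "bounded (f ` C)"
    by (simp add: compact_imp_bounded)
  then obtain B where B: "B > 0" "\<And>t. t \<in> C \<Longrightarrow> cmod (f t) \<le> B"
    by (auto simp: bounded_pos)
  have "cmod (f t) \<le> max 1 B" for t
    using B(2)[of t] C(2) C0_outside[OF f, of t] by (cases "t \<in> topspace K"; cases "t \<in> C") force+
  then show ?thesis
    using that[of "max 1 B"] by simp
qed

lemma continuous_map_complex_mult:
  fixes f g :: "'a \<Rightarrow> complex"
  shows "continuous_map K euclidean f \<Longrightarrow> continuous_map K euclidean g \<Longrightarrow>
    continuous_map K euclidean (\<lambda>t. f t * g t)"
  by (simp add: continuous_map_atin tendsto_mult)

text \<open>Asking only that \<open>g\<close> be continuous and bounded covers products in the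
  algebra and multiplication by constants alike.\<close>

lemma C0_mult_bounded:
  assumes f: "f \<in> carrier (C0 K)" and g: "continuous_map K euclidean g"
    and M: "\<And>t. cmod (g t) \<le> M"
  shows "(\<lambda>t. g t * f t) \<in> carrier (C0 K)"
proof (rule C0_memI)
  show "continuous_map K euclidean (\<lambda>t. g t * f t)"
    by (intro continuous_map_complex_mult g C0_continuous f)
  show "g t * f t = 0" if "t \<notin> topspace K" for t
    using that f by (simp add: C0_outside)
  fix e :: real
  assume e: "e > 0"
  have M0: "M \<ge> 0"
    using M norm_ge_zero order_trans by blast
  \<comment> \<open>Dividing by \<open>M + 1\<close> instead of \<open>M\<close> includes the case
    \<open>M = 0\<close>.\<close>
  then obtain C where C: "compactin K C" "\<forall>t\<in>topspace K - C. cmod (f t) < e / (M + 1)"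
    using C0_vanishing[OF f, of "e / (M + 1)"] e by auto
  have "cmod (g t * f t) < e" if "t \<in> topspace K - C" for t
  proof -
    have "cmod (g t * f t) \<le> (M + 1) * cmod (f t)"
      using M[of t] by (simp add: norm_mult mult_right_mono)
    also have "\<dots> < e"
      using C(2) that M0 by (simp add: field_simps)
    finally show ?thesis .
  qed
  then show "\<exists>C. compactin K C \<and> (\<forall>t\<in>topspace K - C. cmod (g t * f t) < e)"
    using C(1) by blast
qed

lemma C0_mult:
  assumes "f \<in> carrier (C0 K)" "g \<in> carrier (C0 K)"
  shows "(\<lambda>t. f t * g t) \<in> carrier (C0 K)"
  using C0_bounded[OF assms(1)] C0_mult_bounded[OF assms(2) C0_continuous[OF assms(1)]] by metis

lemma C0_smult: "f \<in> carrier (C0 K) \<Longrightarrow> (\<lambda>t. c * f t) \<in> carrier (C0 K)"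
  by (rule C0_mult_bounded[where M = "cmod c"]) auto

lemma C0_star:
  assumes "f \<in> carrier (C0 K)"
  shows "(\<lambda>t. cnj (f t)) \<in> carrier (C0 K)"
proof (rule C0_memI)
  show "continuous_map K euclidean (\<lambda>t. cnj (f t))"
    using C0_continuous[OF assms] by (simp add: continuous_map_atin tendsto_cnj)
qed (use assms in \<open>auto simp: C0_outside C0_vanishing\<close>)

text \<open>Local compactness gives an open \<open>U\<close> around \<open>t\<close> inside a
  compact \<open>C\<close>; complete regularity gives a function that is \<open>0\<close> at
  \<open>t\<close> and \<open>1\<close> off \<open>U\<close>. One minus it vanishes off
  \<open>C\<close>.\<close>

lemma C0_bump:
  assumes "locally_compact_space K" "Hausdorff_space K" "t \<in> topspace K"
  obtains y where "y \<in> carrier (C0 K)" "y t = 1" "\<And>s. cmod (y s) \<le> 1"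
proof -
  obtain U C where U: "openin K U" "compactin K C" "t \<in> U" "U \<subseteq> C"
    using assms by (auto simp: locally_compact_space_def)
  have "completely_regular_space K"
    using assms by (simp add: locally_compact_regular_imp_completely_regular_space)
  moreover have "closedin K (topspace K - U)" "t \<in> topspace K - (topspace K - U)"
    using U assms(3) by auto
  ultimately obtain f :: "'a \<Rightarrow> real" where f: "continuous_map K (top_of_set {0..1}) f" "f t = 0"
      "f ` (topspace K - U) \<subseteq> {1}"
    unfolding completely_regular_space_def by meson
  have cont: "continuous_map K euclidean f" and range: "s \<in> topspace K \<Longrightarrow> f s \<in> {0..1}" for s
    using f(1) by (auto simp: continuous_map_in_subtopology)
  define y :: "'a \<Rightarrow> complex" where "y s = (if s \<in> topspace K then of_real (1 - f s) else 0)" for s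
  have "continuous_map K euclidean (\<lambda>s. complex_of_real (1 - f s))"
    using cont by (simp add: continuous_map_atin tendsto_diff tendsto_of_real)
  then have "continuous_map K euclidean y"
    by (rule continuous_map_eq) (simp add: y_def)
  moreover have "y s = 0" if "s \<in> topspace K - C" for s
    using f(3) U(4) that by (auto simp: y_def image_subset_iff)
  ultimately have "y \<in> carrier (C0 K)"
    using U(2) by (intro C0_memI) (auto simp: y_def intro!: exI[of _ C])
  moreover have "cmod (y s) \<le> 1" for s
    using range[of s] by (auto simp: y_def simp del: of_real_diff)
  ultimately show ?thesis
    using that[of y] f(2) assms(3) by (auto simp: y_def)
qed

text \<open>The sets where the modulus of \<open>f\<close> is at least \<open>1 / (n + 1)\<close>
  are closed and lie in compact sets, and they exhaust the nonzero set.\<close>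

lemma C0_nonzero_set_sigma_compact:
  assumes f: "f \<in> carrier (C0 K)"
  shows "sigma_compactin K {t. f t \<noteq> 0}"
proof -
  define C where "C n = {t \<in> topspace K. cmod (f t) \<in> {inverse (real (Suc n))..}}" for n
  have "compactin K (C n)" for n
  proof -
    obtain D where D: "compactin K D" "\<forall>t\<in>topspace K - D. cmod (f t) < inverse (real (Suc n))"
      using C0_vanishing[OF f, of "inverse (real (Suc n))"] by auto
    have "closedin K (C n)"
      unfolding C_def
      by (rule closedin_continuous_map_preimage[of _ euclidean])
         (auto intro!: continuous_map_norm C0_continuous f)
    moreover have "C n \<subseteq> D"
      using D(2) by (force simp: C_def)
    ultimately show ?thesis
      using closed_compactin[OF D(1)] by blast
  qed
  moreover have "{t. f t \<noteq> 0} = \<Union>(range C)"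
  proof (intro equalityI subsetI)
    fix t
    assume t: "t \<in> {t. f t \<noteq> 0}"
    then obtain n where "inverse (real (Suc n)) < cmod (f t)"
      using reals_Archimedean[of "cmod (f t)"] by auto
    then have "t \<in> C n"
      using t C0_outside[OF f] by (auto simp: C_def)
    then show "t \<in> \<Union>(range C)" by blast
  next
    fix t
    assume "t \<in> \<Union>(range C)"
    then obtain n where "inverse (real (Suc n)) \<le> cmod (f t)"
      by (auto simp: C_def)
    then have "0 < cmod (f t)"
      by (rule less_le_trans[rotated]) simp
    then show "t \<in> {t. f t \<noteq> 0}" by simp
  qed
  ultimately show ?thesis
    unfolding sigma_compactin_def by (intro exI[of _ "range C"]) auto
qed

lemma sigma_compactin_UN:
  assumes "countable I" "\<And>i. i \<in> I \<Longrightarrow> sigma_compactin K (S i)"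
  shows "sigma_compactin K (\<Union>i\<in>I. S i)"
proof -
  obtain \<C> where "\<And>i. i \<in> I \<Longrightarrow> countable (\<C> i) \<and> (\<forall>C\<in>\<C> i. compactin K C) \<and> S i = \<Union>(\<C> i)"
    using assms(2) unfolding sigma_compactin_def by metis
  then show ?thesis
    using assms(1) unfolding sigma_compactin_def
    by (intro exI[of _ "\<Union>i\<in>I. \<C> i"]) auto
qed

text \<open>Bump functions force a unit to be \<open>1\<close> at every point, and the constant
  \<open>1\<close> vanishes at infinity only on a compact space. This selects the branch of
  \<open>unitization\<close> in which scalars are adjoined.\<close>

lemma C0_unital_imp_compact:
  assumes "locally_compact_space K" "Hausdorff_space K" "unital (C0 K)"
  shows "compactin K (topspace K)"
proof -
  obtain e where e: "is_unit_of (C0 K) e"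
    using assms(3) by (auto simp: unital_def)
  have e1: "e t = 1" if t: "t \<in> topspace K" for t
  proof -
    obtain y where y: "y \<in> carrier (C0 K)" "y t = 1"
      using C0_bump[OF assms(1,2) t] by metis
    then have "(\<lambda>s. e s * y s) = y"
      using e by (auto simp: is_unit_of_def)
    then show ?thesis
      using y(2) by (metis mult.right_neutral)
  qed
  obtain C where C: "compactin K C" "\<forall>t\<in>topspace K - C. cmod (e t) < 1"
    using e C0_vanishing[of e K 1] by (auto simp: is_unit_of_def)
  then have "topspace K = C"
    using e1 compactin_subset_topspace[OF C(1)] by force
  then show ?thesis
    using C(1) by simp
qed

section \<open>The unitalization and its point evaluations\<close>

locale nonunital_C0 =
  fixes K :: "'a topology"
  assumes nonunital: "\<not> unital (C0 K)"
begin

abbreviation A where "A \<equiv> unitization (C0 K)"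

lemma carrier_A: "carrier A = carrier (C0 K) \<times> UNIV"
  using nonunital by (simp add: unitization_def)

lemma A_simps:
  "(f, r) \<otimes>\<^bsub>A\<^esub> (g, s) = ((\<lambda>t. f t * g t + (r * g t + s * f t)), r * s)"
  "\<one>\<^bsub>A\<^esub> = (\<lambda>t. 0, 1)" "\<zero>\<^bsub>A\<^esub> = (\<lambda>t. 0, 0)"
  "(f, r) \<oplus>\<^bsub>A\<^esub> (g, s) = (\<lambda>t. f t + g t, r + s)"
  "smult A c (f, r) = (\<lambda>t. c * f t, c * r)"
  "star A (f, r) = (\<lambda>t. cnj (f t), cnj r)"
  using nonunital by (auto simp: unitization_def)

lemma ring_A: "ring A"
proof (rule ringI)
  show "abelian_group A"
  proof (rule abelian_groupI)
    fix x
    assume "x \<in> carrier A"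
    then obtain f r where x: "x = (f, r)" "f \<in> carrier (C0 K)"
      by (auto simp: carrier_A)
    then show "\<exists>y\<in>carrier A. y \<oplus>\<^bsub>A\<^esub> x = \<zero>\<^bsub>A\<^esub>"
      using C0_smult[OF x(2), of "-1"]
      by (intro bexI[of _ "(\<lambda>t. - f t, - r)"]) (auto simp: A_simps carrier_A)
  qed (auto simp: carrier_A A_simps add_ac C0_add C0_zero)
  show "monoid A"
    by (rule monoidI)
       (auto simp: carrier_A A_simps fun_eq_iff algebra_simps intro!: C0_add C0_mult C0_zero C0_smult)
qed (auto simp: carrier_A A_simps algebra_simps)

sublocale star_algebra A
proof (intro star_algebra.intro ring_A star_algebra_axioms.intro)
  fix a
  assume "a \<in> carrier A"
  moreover interpret ring A by (rule ring_A)
  have "smult A (-1) a = \<ominus>\<^bsub>A\<^esub> a" if "a \<in> carrier A"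
    using that C0_smult[of "fst a" K "-1"]
    by (intro minus_equality[symmetric]) (auto simp: carrier_A A_simps)
  ultimately show "smult A (-1) a = \<ominus>\<^bsub>A\<^esub> a" by blast
qed (auto simp: carrier_A A_simps algebra_simps C0_smult C0_star)

text \<open>Restricted to the carrier because \<open>states\<close> consists of extensional
  functions. For \<open>t\<close> outside \<open>topspace K\<close> this is the character at
  infinity, \<open>(f, r) \<mapsto> r\<close>, so it is a character for every
  \<open>t\<close>.\<close>

definition eval_char :: "'a \<Rightarrow> ('a \<Rightarrow> complex) \<times> complex \<Rightarrow> complex" where
  "eval_char t = (\<lambda>(f, r)\<in>carrier A. f t + r)"

lemma eval_char_eq: "f \<in> carrier (C0 K) \<Longrightarrow> eval_char t (f, r) = f t + r"
  by (simp add: eval_char_def carrier_A)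

lemma eval_char_mult: "a \<in> carrier A \<Longrightarrow> b \<in> carrier A \<Longrightarrow>
    eval_char t (a \<otimes>\<^bsub>A\<^esub> b) = eval_char t a * eval_char t b"
  by (auto simp: carrier_A A_simps eval_char_eq C0_add C0_mult C0_smult algebra_simps)

lemma eval_char_star: "a \<in> carrier A \<Longrightarrow> eval_char t (star A a) = cnj (eval_char t a)"
  by (auto simp: carrier_A A_simps eval_char_eq C0_star)

lemma eval_char_state: "eval_char t \<in> states A"
proof -
  have "eval_char t (star A a \<otimes>\<^bsub>A\<^esub> a) \<in> \<real>\<^sub>\<ge>\<^sub>0" if "a \<in> carrier A" for a
    using that complex_norm_square[of "eval_char t a"]
    by (simp add: eval_char_mult eval_char_star mult.commute complex_nonneg_Reals_iff)
  moreover have "eval_char t \<in> extensional (carrier A)"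
    by (auto simp: eval_char_def)
  ultimately show ?thesis
    unfolding states_def
    by (auto simp: carrier_A A_simps eval_char_eq C0_add C0_smult C0_zero algebra_simps)
qed

end

sublocale nonunital_C0 \<subseteq> ev: star_algebra_character "unitization (C0 K)" "eval_char t" for t
  by unfold_locales (auto simp: eval_char_state eval_char_mult eval_char_star)

context nonunital_C0
begin

text \<open>The norm is that of left multiplication on \<open>C0 K\<close>; applied to a bump
  function that is \<open>1\<close> at \<open>t\<close>, it dominates the value at
  \<open>t\<close>.\<close>

lemma cnorm_eval_char:
  assumes K: "locally_compact_space K" "Hausdorff_space K" and t: "t \<in> topspace K"
    and a: "a \<in> carrier A"
  shows "cmod (eval_char t a) \<le> cnorm A a"
proof -
  obtain f r where fr: "a = (f, r)" "f \<in> carrier (C0 K)"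
    using a by (auto simp: carrier_A)
  obtain M where M: "\<And>s. cmod (f s) \<le> M"
    using C0_bounded[OF fr(2)] by metis
  obtain y where y: "y \<in> carrier (C0 K)" "y t = 1" "\<And>s. cmod (y s) \<le> 1"
    using C0_bump[OF K t] by metis
  define B where "B = {b \<in> carrier (C0 K). (SUP s. cmod (b s)) \<le> 1}"
  \<comment> \<open>One bound for all \<open>b\<close> and \<open>s\<close> makes both nested real
    suprema genuine upper bounds.\<close>
  have pointwise: "cmod (f s * b s + r * b s) \<le> M + cmod r" if b: "b \<in> B" for b s
  proof -
    obtain N where "\<And>s. cmod (b s) \<le> N"
      using C0_bounded[of b K] b unfolding B_def by blast
    then have "bdd_above (range (\<lambda>s. cmod (b s)))"
      by (auto simp: bdd_above_def)
    then have "cmod (b s) \<le> 1"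
      using b cSUP_upper2[of "\<lambda>s. cmod (b s)" UNIV s "cmod (b s)"] by (auto simp: B_def)
    then have "cmod (f s + r) * cmod (b s) \<le> (M + cmod r) * 1"
      using M[of s] norm_triangle_ineq[of "f s" r] order_trans[OF norm_ge_zero M[of s]]
      by (intro mult_mono) auto
    then show ?thesis
      by (simp flip: norm_mult add: algebra_simps)
  qed
  have yB: "y \<in> B"
    using y by (auto simp: B_def intro!: cSUP_least)
  have "cmod (eval_char t a) = cmod (f t * y t + r * y t)"
    using fr y by (simp add: eval_char_eq)
  also have "\<dots> \<le> (SUP s. cmod (f s * y s + r * y s))"
    by (rule cSUP_upper) (auto simp: bdd_above_def intro: pointwise[OF yB])
  also have "\<dots> \<le> (SUP b\<in>B. SUP s. cmod (f s * b s + r * b s))"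
  proof (rule cSUP_upper[OF yB])
    show "bdd_above ((\<lambda>b. SUP s. cmod (f s * b s + r * b s)) ` B)"
      unfolding bdd_above_def by (auto intro!: exI[of _ "M + cmod r"] cSUP_least pointwise)
  qed
  also have "\<dots> = cnorm A a"
    by (simp add: unitization_def fr B_def)
  finally show ?thesis .
qed

section \<open>Frame series evaluated at a point\<close>

abbreviation N where "N \<equiv> self_module (C0 K)"

lemma m_inner_simp: "m_inner N x y = (\<lambda>t. cnj (x t) * y t, 0)"
  and m_carrier_simp: "m_carrier N = carrier (C0 K)"
  by (simp_all add: self_module_def)

lemma m_inner_closed: "x \<in> carrier (C0 K) \<Longrightarrow> y \<in> carrier (C0 K) \<Longrightarrow> m_inner N x y \<in> carrier A"
  by (simp add: m_inner_simp carrier_A C0_mult C0_star)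

lemma eval_char_m_inner:
  "x \<in> carrier (C0 K) \<Longrightarrow> y \<in> carrier (C0 K) \<Longrightarrow> eval_char t (m_inner N x y) = cnj (x t) * y t"
  by (simp add: m_inner_simp eval_char_eq C0_mult C0_star)

lemma frame_partial_sum_closed:
  assumes "finite F" "x ` F \<subseteq> carrier (C0 K)" "y \<in> carrier (C0 K)"
  shows "frame_partial_sum A N x y F \<in> carrier A"
  unfolding frame_partial_sum_def
  using assms by (intro finsum_closed) (auto intro!: m_inner_closed)

text \<open>At \<open>t\<close> each term is \<open>cnj (y t) * x j t\<close> times its own
  conjugate.\<close>

lemma eval_char_frame_partial_sum:
  assumes "finite F" "x ` F \<subseteq> carrier (C0 K)" "y \<in> carrier (C0 K)"
  shows "eval_char t (frame_partial_sum A N x y F) = of_real (\<Sum>j\<in>F. (cmod (y t))\<^sup>2 * (cmod (x j t))\<^sup>2)"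
proof -
  have "eval_char t (frame_partial_sum A N x y F) =
      (\<Sum>j\<in>F. eval_char t (m_inner N y (x j) \<otimes>\<^bsub>A\<^esub> m_inner N (x j) y))"
    unfolding frame_partial_sum_def
    using assms by (intro ev.phi_finsum) (auto intro!: m_inner_closed)
  also have "\<dots> = (\<Sum>j\<in>F. of_real ((cmod (y t))\<^sup>2 * (cmod (x j t))\<^sup>2))"
  proof (rule sum.cong)
    fix j assume "j \<in> F"
    then have "x j \<in> carrier (C0 K)" using assms by auto
    then show "eval_char t (m_inner N y (x j) \<otimes>\<^bsub>A\<^esub> m_inner N (x j) y) =
        of_real ((cmod (y t))\<^sup>2 * (cmod (x j t))\<^sup>2)"
      using assms(3)
      by (simp add: eval_char_mult m_inner_closed eval_char_m_inner complex_norm_square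
          del: of_real_power)
  qed simp
  finally show ?thesis by simp
qed

lemma is_frame_has_sum:
  assumes K: "locally_compact_space K" "Hausdorff_space K" and t: "t \<in> topspace K"
    and frame: "is_frame A N J x"
  obtains L :: real where "L > 0" "((\<lambda>j. (cmod (x j t))\<^sup>2) has_sum L) J"
proof -
  obtain y where y: "y \<in> carrier (C0 K)" "y t = 1"
    using C0_bump[OF K t] by metis
  have xJ: "x ` J \<subseteq> carrier (C0 K)"
    using frame by (auto simp: is_frame_def standard_frame_def nonstandard_frame_def m_carrier_simp)
  let ?s = "frame_partial_sum A N x y"
  have closed: "\<forall>\<^sub>F F in finite_subsets_at_top J. ?s F \<in> carrier A"
    using xJ y by (intro eventually_finite_subsets_at_top_weakI frame_partial_sum_closed) auto
  \<comment> \<open>What the two kinds of frame have in common at \<open>t\<close>: a limit of the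
    evaluated partial sums, bounded below by the evaluated lower frame bound.\<close>
  have "\<exists>c>0. \<exists>l. ((\<lambda>F. eval_char t (?s F)) \<longlongrightarrow> l) (finite_subsets_at_top J) \<and>
      l - eval_char t (smult A (of_real c) (m_inner N y y)) \<in> \<real>\<^sub>\<ge>\<^sub>0"
    using frame unfolding is_frame_def
  proof (elim disjE)
    assume "standard_frame A N J x"
    then obtain c s where c: "c > 0" and s: "s \<in> carrier A"
      and lim: "((\<lambda>F. cnorm A (?s F \<ominus>\<^bsub>A\<^esub> s)) \<longlongrightarrow> 0) (finite_subsets_at_top J)"
      and le: "cstar_le A (smult A (of_real c) (m_inner N y y)) s"
      using y(1) unfolding standard_frame_def m_carrier_simp by blast
    have "((\<lambda>F. eval_char t (?s F) - eval_char t s) \<longlongrightarrow> 0) (finite_subsets_at_top J)"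
    proof (rule Lim_null_comparison[OF _ lim])
      show "\<forall>\<^sub>F F in finite_subsets_at_top J.
          cmod (eval_char t (?s F) - eval_char t s) \<le> cnorm A (?s F \<ominus>\<^bsub>A\<^esub> s)"
        using closed
      proof eventually_elim
        case (elim F)
        then show ?case
          using cnorm_eval_char[OF K t, of "?s F \<ominus>\<^bsub>A\<^esub> s"] s by (simp add: ev.phi_minus)
      qed
    qed
    then have "((\<lambda>F. eval_char t (?s F)) \<longlongrightarrow> eval_char t s) (finite_subsets_at_top J)"
      by (simp add: LIM_zero_iff)
    moreover have "eval_char t s - eval_char t (smult A (of_real c) (m_inner N y y)) \<in> \<real>\<^sub>\<ge>\<^sub>0"
      using le y s by (intro ev.cstar_le_character) (auto intro!: m_inner_closed)
    ultimately show ?thesis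
      using c by blast
  next
    assume "nonstandard_frame A N J x"
    then obtain c T where c: "c > 0" and T: "T \<in> enveloping_vN A"
      and lim: "ultraweak_tendsto A (\<lambda>F. univ_rep A (?s F)) T (finite_subsets_at_top J)"
      and le: "op_le A (univ_rep A (smult A (of_real c) (m_inner N y y))) T"
      using y(1) unfolding nonstandard_frame_def m_carrier_simp by blast
    \<comment> \<open>A bicommutant is itself a commutant, hence made of bounded linear
      operators.\<close>
    have "T \<in> bounded_ops A"
      using T by (simp add: enveloping_vN_def commutant_def)
    then show ?thesis
      using c ev.ultraweak_tendsto_character[OF _ lim closed] y
        ev.op_le_character[OF le smult_closed[OF m_inner_closed]] by blast
  qed
  then obtain c l where c: "c > 0"
    and l: "((\<lambda>F. eval_char t (?s F)) \<longlongrightarrow> l) (finite_subsets_at_top J)"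
    and le: "l - eval_char t (smult A (of_real c) (m_inner N y y)) \<in> \<real>\<^sub>\<ge>\<^sub>0"
    by blast
  \<comment> \<open>Since \<open>y t = 1\<close>, the lower bound at \<open>t\<close> is the
    constant \<open>c\<close> itself.\<close>
  have "eval_char t (smult A (of_real c) (m_inner N y y)) = of_real c"
    using y by (simp add: ev.phi_smult m_inner_closed eval_char_m_inner)
  then have "Re l > 0"
    using le c by (auto simp: complex_nonneg_Reals_iff)
  \<comment> \<open>\<open>has_sum\<close> is convergence along the same net of finite partial sums,
    so taking real parts suffices.\<close>
  moreover have "((\<lambda>j. (cmod (x j t))\<^sup>2) has_sum Re l) J"
    unfolding has_sum_def
  proof (rule Lim_transform_eventually[OF tendsto_Re[OF l]])
    show "\<forall>\<^sub>F F in finite_subsets_at_top J. Re (eval_char t (?s F)) = (\<Sum>j\<in>F. (cmod (x j t))\<^sup>2)"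
      using xJ y
      by (intro eventually_finite_subsets_at_top_weakI)
         (subst eval_char_frame_partial_sum, auto)
  qed
  ultimately show ?thesis
    using that by blast
qed

end

section \<open>Nonexistence of frames\<close>

theorem theorem2p6:
  fixes K :: "'a topology"
  assumes "locally_compact_space K" and "Hausdorff_space K"
    and "\<not> sigma_compactin K (topspace K)"
    and "\<exists>D. D \<subseteq> topspace K \<and> sigma_compactin K D \<and> K closure_of D = topspace K"
    and "separable_space K"
  shows "\<not> (\<exists>(J :: 'j set) x. is_frame (unitization (C0 K)) (self_module (C0 K)) J x)"
proof
  assume "\<exists>(J :: 'j set) x. is_frame (unitization (C0 K)) (self_module (C0 K)) J x"
  then obtain J :: "'j set" and x where
    frame: "is_frame (unitization (C0 K)) (self_module (C0 K)) J x" by blast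
  \<comment> \<open>A compact space is \<sigma>-compact by a one-element cover; hence
    \<open>C0 K\<close> has no unit.\<close>
  have "\<not> compactin K (topspace K)"
    using assms(3) unfolding sigma_compactin_def by (metis countable_empty countable_insert ccpo_Sup_singleton singletonD)
  then interpret nonunital_C0 K
    using C0_unital_imp_compact[OF assms(1,2)] by unfold_locales blast
  note sums = is_frame_has_sum[OF assms(1,2) _ frame]
  have xJ: "x j \<in> carrier (C0 K)" if "j \<in> J" for j
    using that frame
    by (auto simp: is_frame_def standard_frame_def nonstandard_frame_def m_carrier_simp)
  obtain S where S: "countable S" "S \<subseteq> topspace K" "K closure_of S = topspace K"
    using assms(5) by (auto simp: separable_space_def)
  \<comment> \<open>The indices whose functions are nonzero at some point of the countable dense
    set.\<close>
  define I where "I = (\<Union>t\<in>S. {j \<in> J. x j t \<noteq> 0})"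
  have "countable {j \<in> J. x j t \<noteq> 0}" if t: "t \<in> topspace K" for t
  proof -
    obtain L where "((\<lambda>j. (cmod (x j t))\<^sup>2) has_sum L) J"
      using sums[OF t] by blast
    then show ?thesis
      using summable_countable_real[of "\<lambda>j. (cmod (x j t))\<^sup>2" J] by (auto simp: summable_on_def)
  qed
  then have "countable I"
    unfolding I_def using S by (intro countable_UN) auto
  \<comment> \<open>Equality with the zero function passes from \<open>S\<close> to its closure
    because the complex plane is Hausdorff.\<close>
  have zero: "x j t = 0" if "j \<in> J - I" "t \<in> topspace K" for j t
    using forall_in_closure_of_eq[of t K S euclidean "x j" "\<lambda>_. 0"] that S C0_continuous[OF xJ[of j]]
    by (auto simp: I_def)
  have "topspace K = (\<Union>j\<in>I. {t. x j t \<noteq> 0})"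
  proof (intro equalityI subsetI)
    fix t
    assume t: "t \<in> topspace K"
    then obtain L where L: "L > 0" "((\<lambda>j. (cmod (x j t))\<^sup>2) has_sum L) J"
      using sums by blast
    \<comment> \<open>Positivity of \<open>L\<close>, inherited from the lower frame constant, is
      what makes the nonzero sets cover \<open>K\<close>.\<close>
    have "\<exists>j\<in>J. x j t \<noteq> 0"
    proof (rule ccontr)
      assume "\<not> (\<exists>j\<in>J. x j t \<noteq> 0)"
      then have "((\<lambda>j. (cmod (x j t))\<^sup>2) has_sum 0) J"
        by (intro has_sum_0) auto
      then show False
        using L has_sum_unique by blast
    qed
    then show "t \<in> (\<Union>j\<in>I. {t. x j t \<noteq> 0})"
      using zero t by blast
  next
    fix t
    assume "t \<in> (\<Union>j\<in>I. {t. x j t \<noteq> 0})"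
    then show "t \<in> topspace K"
      using C0_outside[OF xJ] by (auto simp: I_def)
  qed
  moreover have "sigma_compactin K (\<Union>j\<in>I. {t. x j t \<noteq> 0})"
    using \<open>countable I\<close> xJ
    by (intro sigma_compactin_UN C0_nonzero_set_sigma_compact) (auto simp: I_def)
  ultimately show False
    using assms(3) by simp
qed

end
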